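(* Let $\boldsymbol{\mathcal{A}}=(\mathcal{A}_0,\dots,\mathcal{A}_n)$ be a family of nonempty finite subsets of a lattice $M$ of rank $n$, let $\boldsymbol{\rho}=(\rho_0,\dots,\rho_n)$ be a family of convex piecewise affine functions $\rho_i\colon\Delta_i\to\mathbb{R}$ defined on $\mathcal{A}_i$, with $\Delta_i=\operatorname{conv}(\mathcal{A}_i)$, whose inf-convolution $\rho$ induces a tight mixed subdivision $S(\rho)$ of $\Delta=\sum_i\Delta_i$, and let $\delta\in M_{\mathbb{R}}$ be generic with respect to $S(\rho)$. For every subset $\mathcal{C}\subset\mathcal{B}=(\Delta+\delta)\cap M$, the principal minor $H_{\boldsymbol{\mathcal{A}},\boldsymbol{\rho},\mathcal{C}}$ is homogeneous in each set of variables $\boldsymbol{u}_i$ and with respect to the grading $\deg_M$. Moreover, $$\deg_{\boldsymbol{u}_i}(H_{\boldsymbol{\mathcal{A}},\boldsymbol{\rho},\mathcal{C}})=\#(\mathcal{B}_i\cap\mathcal{C}),\ i=0,\dots,n,\quad\text{and}\quad\deg_M(H_{\boldsymbol{\mathcal{A}},\boldsymbol{\rho},\mathcal{C}})=\sum_{b\in\mathcal{C}}a(b).$$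
   Context: Polyhedral notation. $M\simeq\mathbb{Z}^n$, $N=\operatorname{Hom}(M,\mathbb{Z})$, $M_{\mathbb{R}}=M\otimes\mathbb{R}$, $N_{\mathbb{R}}=N\otimes\mathbb{R}$. For a convex piecewise affine function $\rho\colon\Delta\to\mathbb{R}$ on a polytope and $v\in N_{\mathbb{R}}$ put $\Gamma(\rho,v)=\{x\in\Delta\mid \rho(x)+\langle v,x\rangle=\min_{y\in\Delta}(\rho(y)+\langle v,y\rangle)\}$. The subdivision $S(\rho)$ of $\Delta$ is the collection of all the sets $\Gamma(\rho,v)$, called cells; an $n$-cell is a cell of dimension $n$. The inf-convolution of $\rho_i\colon\Delta_i\to\mathbb{R}$, $i=0,\dots,n$, is $\rho=\boxplus_i\rho_i\colon\Delta=\sum_i\Delta_i\to\mathbb{R}$, $\rho(x)=\inf\{\sum_i\rho_i(x_i)\mid x_i\in\Delta_i,\sum_ix_i=x\}$, and $S(\rho)$ is called a mixed subdivision of $\Delta$. The $i$-th component of $C\in S(\rho)$ is the set $C_i$ of $x_i\in\Delta_i$ for which there are $x_j\in\Delta_j$, $j\ne i$, with $\sum_jx_j\in C$ and $\rho(\sum_jx_j)=\sum_j\rho_j(x_j)$; if $C=\Gamma(\rho,v)$ then $C_i=\Gamma(\rho_i,v)$. $S(\rho)$ is tight if $\sum_{i}\dim(C_i)=n$ for every $n$-cell $C$. The function $\rho_i$ is defined on $\mathcal{A}_i$ if there is $\boldsymbol{\nu}_i\in\mathbb{R}^{\mathcal{A}_i}$ such that $\rho_i(x)=\min\{z\mid(x,z)\in\operatorname{conv}\{(a,\nu_{i,a})\}_{a\in\mathcal{A}_i}\}$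 for all $x\in\Delta_i$. Genericity of $\delta$: $(|S(\rho)^{n-1}|+\delta)\cap M=\emptyset$, where $|S(\rho)^{n-1}|$ is the $(n-1)$-skeleton of $S(\rho)$, i.e. the union of its cells of dimension at most $n-1$. Canny-Emiris matrix. Let $\boldsymbol{u}_i=\{u_{i,a}\}_{a\in\mathcal{A}_i}$ be variables, $\boldsymbol{u}=(\boldsymbol{u}_0,\dots,\boldsymbol{u}_n)$ and $\mathbb{K}=\mathbb{C}(\boldsymbol{u})$. Each $b\in\mathcal{B}=(\Delta+\delta)\cap M$ lies in $C+\delta$ for a unique $n$-cell $C$ of $S(\rho)$; let $i(b)$ be the largest $i$ with $\dim(C_i)=0$, and $a(b)\in\mathcal{A}_{i(b)}$ the unique point of $C_{i(b)}$. Set $\mathcal{B}_i=\{b\in\mathcal{B}\mid i(b)=i\}$. The Canny-Emiris matrix $\mathcal{H}_{\boldsymbol{\mathcal{A}},\boldsymbol{\rho}}\in\mathbb{K}^{\mathcal{B}\times\mathcal{B}}$ has entry at $(b,b')$ equal to $u_{i(b),\,b'-b+a(b)}$ if $b'-b+a(b)\in\mathcal{A}_{i(b)}$, and $0$ otherwise. $H_{\boldsymbol{\mathcal{A}},\boldsymbol{\rho},\mathcal{C}}\in\mathbb{Z}[\boldsymbol{u}]$ is its principal minor indexed by $\mathcal{C}$ (equal to $1$ if $\mathcal{C}=\emptyset$); it is a nonzero polynomial. Grading. $\deg_M$ is the grading of the monomials of $\mathbb{C}[\boldsymbol{u}]$ with values in $M$ defined by $\deg_M(u_{i,a})=a$ for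 $i=0,\dots,n$ and $a\in\mathcal{A}_i$. *)

theory Defs
  imports
    "HOL-Analysis.Analysis"
    "HOL-Library.Poly_Mapping"
    "HOL-Library.Set_Algebras"
    "HOL-Combinatorics.Permutations"
begin

section \<open>Lattices and piecewise affine functions\<close>

text \<open>
  A lattice \<open>M\<close> of rank \<open>n\<close> is placed in a Euclidean space as the integer span of \<open>n\<close> linearly
  independent vectors, so that \<open>M \<otimes> \<real>\<close> is \<^term>\<open>span M\<close>.  The ambient space may have dimension
  larger than \<open>n\<close>; this makes room for rank 0.  Every linear form on \<^term>\<open>span M\<close> extends to the
  ambient space, so elements of the dual space are rendered as linear forms on the ambient space.
\<close>

definition lattice_of_rank :: "nat \<Rightarrow> 'a::euclidean_space set \<Rightarrow> bool" where
  "lattice_of_rank n M \<longleftrightarrow>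
     (\<exists>E. independent E \<and> finite E \<and> card E = n \<and>
          M = {\<Sum>e\<in>E. of_int (c e) *\<^sub>R e | c :: 'a \<Rightarrow> int. True})"

definition piecewise_affine_on :: "'a::euclidean_space set \<Rightarrow> ('a \<Rightarrow> real) \<Rightarrow> bool" where
  "piecewise_affine_on D f \<longleftrightarrow>
     (\<exists>\<P>. finite \<P> \<and> \<Union>\<P> = D \<and>
        (\<forall>P\<in>\<P>. polytope P \<and> (\<exists>l c. linear l \<and> (\<forall>x\<in>P. f x = l x + c))))"

definition defined_on :: "('a::euclidean_space \<Rightarrow> real) \<Rightarrow> 'a set \<Rightarrow> bool" where
  "defined_on f A \<longleftrightarrow>
     (\<exists>\<nu>. \<forall>x \<in> convex hull A. f x = (LEAST z. (x, z) \<in> convex hull ((\<lambda>a. (a, \<nu> a)) ` A)))"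


section \<open>Mixed subdivisions\<close>

definition cell :: "'a::euclidean_space set \<Rightarrow> ('a \<Rightarrow> real) \<Rightarrow> ('a \<Rightarrow> real) \<Rightarrow> 'a set" where
  "cell D f v = {x \<in> D. \<forall>y\<in>D. f x + v x \<le> f y + v y}"

definition subdivision :: "'a::euclidean_space set \<Rightarrow> ('a \<Rightarrow> real) \<Rightarrow> 'a set set" where
  "subdivision D f = {cell D f v | v. linear v}"

definition skeleton :: "int \<Rightarrow> 'a::euclidean_space set set \<Rightarrow> 'a set" where
  "skeleton k S = \<Union>{C \<in> S. aff_dim C \<le> k}"

definition inf_convolution ::
  "nat \<Rightarrow> (nat \<Rightarrow> 'a::euclidean_space set) \<Rightarrow> (nat \<Rightarrow> 'a \<Rightarrow> real) \<Rightarrow> 'a \<Rightarrow> real" where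
  "inf_convolution n D \<rho> x =
     Inf {\<Sum>i\<le>n. \<rho> i (y i) | y. (\<forall>i\<le>n. y i \<in> D i) \<and> (\<Sum>i\<le>n. y i) = x}"

text \<open>In \<open>\<Sum>i\<le>n. D i\<close> the sum is the Minkowski sum of sets.\<close>

definition mixed_subdivision ::
  "nat \<Rightarrow> (nat \<Rightarrow> 'a::euclidean_space set) \<Rightarrow> (nat \<Rightarrow> 'a \<Rightarrow> real) \<Rightarrow> 'a set set" where
  "mixed_subdivision n D \<rho> = subdivision (\<Sum>i\<le>n. D i) (inf_convolution n D \<rho>)"

definition cell_component ::
  "nat \<Rightarrow> (nat \<Rightarrow> 'a::euclidean_space set) \<Rightarrow> (nat \<Rightarrow> 'a \<Rightarrow> real) \<Rightarrow> 'a set \<Rightarrow> nat \<Rightarrow> 'a set" where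
  "cell_component n D \<rho> C i =
     {x i | x. (\<forall>j\<le>n. x j \<in> D j) \<and> (\<Sum>j\<le>n. x j) \<in> C \<and>
               inf_convolution n D \<rho> (\<Sum>j\<le>n. x j) = (\<Sum>j\<le>n. \<rho> j (x j))}"

definition tight :: "nat \<Rightarrow> (nat \<Rightarrow> 'a::euclidean_space set) \<Rightarrow> (nat \<Rightarrow> 'a \<Rightarrow> real) \<Rightarrow> bool" where
  "tight n D \<rho> \<longleftrightarrow>
     (\<forall>C \<in> mixed_subdivision n D \<rho>. aff_dim C = int n \<longrightarrow>
        (\<Sum>i\<le>n. aff_dim (cell_component n D \<rho> C i)) = int n)"

definition generic_shift ::
  "'a set \<Rightarrow> nat \<Rightarrow> (nat \<Rightarrow> 'a::euclidean_space set) \<Rightarrow> (nat \<Rightarrow> 'a \<Rightarrow> real) \<Rightarrow> 'a \<Rightarrow> bool" where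
  "generic_shift M n D \<rho> \<delta> \<longleftrightarrow>
     (\<lambda>x. x + \<delta>) ` skeleton (int n - 1) (mixed_subdivision n D \<rho>) \<inter> M = {}"


section \<open>The Canny-Emiris matrix\<close>

abbreviation hulls :: "(nat \<Rightarrow> 'a::euclidean_space set) \<Rightarrow> nat \<Rightarrow> 'a set" where
  "hulls A i \<equiv> convex hull (A i)"

definition index_set ::
  "'a set \<Rightarrow> nat \<Rightarrow> (nat \<Rightarrow> 'a::euclidean_space set) \<Rightarrow> 'a \<Rightarrow> 'a set" where
  "index_set M n A \<delta> = (\<lambda>x. x + \<delta>) ` (\<Sum>i\<le>n. hulls A i) \<inter> M"

definition cell_of ::
  "nat \<Rightarrow> (nat \<Rightarrow> 'a::euclidean_space set) \<Rightarrow> (nat \<Rightarrow> 'a \<Rightarrow> real) \<Rightarrow> 'a \<Rightarrow> 'a \<Rightarrow> 'a set" where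
  "cell_of n A \<rho> \<delta> b =
     (THE C. C \<in> mixed_subdivision n (hulls A) \<rho> \<and> aff_dim C = int n \<and> b \<in> (\<lambda>x. x + \<delta>) ` C)"

definition row_index ::
  "nat \<Rightarrow> (nat \<Rightarrow> 'a::euclidean_space set) \<Rightarrow> (nat \<Rightarrow> 'a \<Rightarrow> real) \<Rightarrow> 'a \<Rightarrow> 'a \<Rightarrow> nat" where
  "row_index n A \<rho> \<delta> b =
     Max {i. i \<le> n \<and> aff_dim (cell_component n (hulls A) \<rho> (cell_of n A \<rho> \<delta> b) i) = 0}"

definition row_point ::
  "nat \<Rightarrow> (nat \<Rightarrow> 'a::euclidean_space set) \<Rightarrow> (nat \<Rightarrow> 'a \<Rightarrow> real) \<Rightarrow> 'a \<Rightarrow> 'a \<Rightarrow> 'a" where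
  "row_point n A \<rho> \<delta> b =
     the_elem (cell_component n (hulls A) \<rho> (cell_of n A \<rho> \<delta> b) (row_index n A \<rho> \<delta> b))"

text \<open>
  The pair \<open>(i, a)\<close> stands for the variable \<open>u\<^sub>i\<^sub>,\<^sub>a\<close>.  A monomial is the finitely supported function of
  its exponents, a polynomial the finitely supported function of its coefficients.  All entries of
  the matrix are variables or 0, so its minors are formed in the subring \<open>\<int>[u]\<close> of \<open>\<complex>(u)\<close>.
\<close>

type_synonym 'a monomial = "nat \<times> 'a \<Rightarrow>\<^sub>0 nat"
type_synonym 'a polynomial = "'a monomial \<Rightarrow>\<^sub>0 int"

definition variable :: "nat \<Rightarrow> 'a \<Rightarrow> 'a polynomial" where
  "variable i a = Poly_Mapping.single (Poly_Mapping.single (i, a) 1) 1"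

definition canny_emiris_matrix ::
  "nat \<Rightarrow> (nat \<Rightarrow> 'a::euclidean_space set) \<Rightarrow> (nat \<Rightarrow> 'a \<Rightarrow> real) \<Rightarrow> 'a \<Rightarrow> 'a \<Rightarrow> 'a \<Rightarrow> 'a polynomial" where
  "canny_emiris_matrix n A \<rho> \<delta> b b' =
     (let i = row_index n A \<rho> \<delta> b; a = b' - b + row_point n A \<rho> \<delta> b
      in if a \<in> A i then variable i a else 0)"

text \<open>The Leibniz formula, as in the library's \<^const>\<open>det\<close>, for rows and columns indexed by a finite set.\<close>

definition principal_minor :: "('b \<Rightarrow> 'b \<Rightarrow> 'c::comm_ring_1) \<Rightarrow> 'b set \<Rightarrow> 'c" where
  "principal_minor H C = (\<Sum>p | p permutes C. of_int (sign p) * (\<Prod>b\<in>C. H b (p b)))"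

definition canny_emiris_minor ::
  "nat \<Rightarrow> (nat \<Rightarrow> 'a::euclidean_space set) \<Rightarrow> (nat \<Rightarrow> 'a \<Rightarrow> real) \<Rightarrow> 'a \<Rightarrow> 'a set \<Rightarrow> 'a polynomial" where
  "canny_emiris_minor n A \<rho> \<delta> C = principal_minor (canny_emiris_matrix n A \<rho> \<delta>) C"


section \<open>Gradings\<close>

definition monomial_deg_u :: "(nat \<Rightarrow> 'a set) \<Rightarrow> nat \<Rightarrow> 'a monomial \<Rightarrow> nat" where
  "monomial_deg_u A i m = (\<Sum>a\<in>A i. Poly_Mapping.lookup m (i, a))"

definition monomial_deg_M :: "nat \<Rightarrow> (nat \<Rightarrow> 'a::real_vector set) \<Rightarrow> 'a monomial \<Rightarrow> 'a" where
  "monomial_deg_M n A m = (\<Sum>i\<le>n. \<Sum>a\<in>A i. of_nat (Poly_Mapping.lookup m (i, a)) *\<^sub>R a)"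

definition homogeneous_wrt :: "('a monomial \<Rightarrow> 'd) \<Rightarrow> 'a polynomial \<Rightarrow> bool" where
  "homogeneous_wrt dg P \<longleftrightarrow> (\<exists>d. \<forall>m\<in>Poly_Mapping.keys P. dg m = d)"

text \<open>
  The next two degrees are meaningful only for nonzero polynomials; their values at 0 are
  unspecified.  The second one is meaningful only for polynomials homogeneous with respect to the
  \<open>M\<close>-grading, and is then the common degree of all monomials.
\<close>

definition deg_u :: "(nat \<Rightarrow> 'a set) \<Rightarrow> nat \<Rightarrow> 'a polynomial \<Rightarrow> nat" where
  "deg_u A i P = Max (monomial_deg_u A i ` Poly_Mapping.keys P)"

definition deg_M :: "nat \<Rightarrow> (nat \<Rightarrow> 'a::real_vector set) \<Rightarrow> 'a polynomial \<Rightarrow> 'a" where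
  "deg_M n A P = the_elem (monomial_deg_M n A ` Poly_Mapping.keys P)"

end

theory Submission
  imports Defs
begin

text \<open>
  Expand the minor over the permutations \<open>p\<close> of \<open>C\<close>.  A nonzero summand is, up to sign, the monomial
  \<open>\<Prod>b\<in>C. u\<^bsub>i(b), p(b) - b + a(b)\<^esub>\<close>.  It has one variable of index \<open>i(b)\<close> for each \<open>b\<close>, which gives
  the degree in each set of variables, and its \<open>M\<close>-degree is \<open>\<Sum>b\<in>C. p b - b + a b\<close>, where the
  differences \<open>p b - b\<close> cancel.  So every monomial of the minor has the stated degrees, and what
  remains is that the minor is not zero.

  The monomial of the identity cannot cancel.  Give \<open>u\<^sub>i\<^sub>,\<^sub>a\<close> the weight \<open>\<rho>\<^sub>i(a)\<close> and write \<open>R\<close> for the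
  inf-convolution.  Replacing the summand \<open>a(b)\<close> by \<open>a' = b' - b + a(b)\<close> in an optimal decomposition of
  \<open>b - \<delta>\<close> yields a decomposition of \<open>b' - \<delta>\<close>, hence
  \<open>R(b' - \<delta>) - R(b - \<delta>) \<le> \<rho>\<^sub>i(a') - \<rho>\<^sub>i(a(b))\<close>.  Along a permutation the left-hand sides sum to 0.  So the
  identity has least weight, and it is the only permutation with that weight once equality is known to
  force \<open>b' = b\<close> (\<open>entry_weight_bound\<close>, \<open>permutation_id_of_potential\<close>).

  The equality case uses genericity in the following form: a point of \<open>M - \<delta>\<close> lies in \<open>\<Gamma>(R, v)\<close> for
  only one \<open>v\<close> in the dual of \<^term>\<open>span M\<close> (\<open>generic_subgradient_unique\<close>).  The difference
  of two such forms is constant on the cell of their midpoint, so this would be a cell of smaller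
  dimension through the point.  In the equality case let \<open>b - \<delta> \<in> \<Gamma>(R, v)\<close> and
  \<open>b' - \<delta> \<in> \<Gamma>(R, w)\<close>.  The summands of \<open>b - \<delta>\<close> other than \<open>a(b)\<close> minimise both \<open>\<rho>\<^sub>j + v\<close> and
  \<open>\<rho>\<^sub>j + w\<close>.  The point \<open>a(b)\<close> is the only minimiser of \<open>\<rho>\<^sub>i + v\<close>, so it stays one when \<open>v\<close> is moved a
  little towards \<open>w\<close> (\<open>component_vertex_persists\<close>).  Then \<open>b - \<delta>\<close> also lies in the cell of the moved
  form, whence \<open>v = w\<close> on \<^term>\<open>span M\<close> and \<open>a' \<in> \<Gamma>(\<rho>\<^sub>i, w) = \<Gamma>(\<rho>\<^sub>i, v) = {a(b)}\<close>.

  Behind this lie two facts about the mixed subdivision.  Its cells cover \<open>\<Delta>\<close>, because the graph of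
  \<open>R\<close> is the lower boundary of a polytope (\<open>cells_cover\<close>).  The components of a cell are the cells of the
  summands for the same linear form (\<open>cell_component_eq\<close>), and by tightness some component of an
  \<open>n\<close>-cell is a point, necessarily one of \<open>A\<^sub>i\<close> (\<open>row_vertex\<close>).
\<close>


section \<open>Subgradients of polyhedral functions\<close>

text \<open>
  A convex function may fail to have a subgradient at a boundary point of its domain; here polyhedrality
  provides one.  Each point \<open>(x, t - e)\<close> below the lower boundary violates one of finitely many
  inequalities.  One of them is therefore violated for arbitrarily small \<open>e\<close>; it is tight at \<open>(x, t)\<close>
  and its coefficient at the last coordinate is negative, so that it bounds \<open>P\<close> from below.
\<close>

lemma polyhedron_lower_support:
  fixes P :: "('a::euclidean_space \<times> real) set"
  assumes "polyhedron P" and xt: "(x, t) \<in> P" and low: "\<And>z. (x, z) \<in> P \<Longrightarrow> t \<le> z"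
  obtains v where "linear v" and "\<And>y z. (y, z) \<in> P \<Longrightarrow> t + v x \<le> z + v y"
proof -
  obtain F where F: "finite F" "P = \<Inter>F" "\<And>h. h \<in> F \<Longrightarrow> \<exists>a b. a \<noteq> 0 \<and> h = {p. a \<bullet> p \<le> b}"
    using \<open>polyhedron P\<close> unfolding polyhedron_def by blast
  have half: "\<exists>\<alpha> \<beta> c. h = {p. \<alpha> \<bullet> fst p + \<beta> * snd p \<le> c}" if h: "h \<in> F" for h
  proof -
    obtain a b where "h = {p. a \<bullet> p \<le> b}" using F(3)[OF h] by auto
    then have "h = {p. fst a \<bullet> fst p + snd a * snd p \<le> b}" by (simp add: inner_prod_def)
    then show ?thesis by blast
  qed
  have "\<exists>h\<in>F. \<forall>e>0. (x, t - e) \<notin> h"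
  proof (rule ccontr)
    assume "\<not> ?thesis"
    then obtain e where e: "\<And>h. h \<in> F \<Longrightarrow> e h > 0 \<and> (x, t - e h) \<in> h" by metis
    define d where "d = Min (insert 1 (e ` F))"
    have d: "d > 0" "\<And>h. h \<in> F \<Longrightarrow> d \<le> e h"
      using F(1) e by (auto simp: d_def)
    have "(x, t - d) \<in> h" if h: "h \<in> F" for h
    proof -
      obtain \<alpha> \<beta> c where hh: "h = {p. \<alpha> \<bullet> fst p + \<beta> * snd p \<le> c}" using half h by blast
      have 1: "\<alpha> \<bullet> x + \<beta> * t \<le> c" and 2: "\<alpha> \<bullet> x + \<beta> * (t - e h) \<le> c"
        using xt e[OF h] h F(2) by (auto simp: hh)
      have "\<beta> * (t - d) \<le> max (\<beta> * t) (\<beta> * (t - e h))"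
      proof (cases "\<beta> \<ge> 0")
        case True
        then have "\<beta> * (t - d) \<le> \<beta> * t" using d by (intro mult_left_mono) auto
        then show ?thesis by simp
      next
        case False
        then have "\<beta> * (t - d) \<le> \<beta> * (t - e h)" using d(2)[OF h] by (intro mult_left_mono_neg) auto
        then show ?thesis by simp
      qed
      with 1 2 show ?thesis by (auto simp: hh)
    qed
    then have "(x, t - d) \<in> P" using F(2) by blast
    from low[OF this] d(1) show False by simp
  qed
  then obtain h where h: "h \<in> F" "\<And>e. e > 0 \<Longrightarrow> (x, t - e) \<notin> h" by blast
  obtain \<alpha> \<beta> c where hh: "h = {p. \<alpha> \<bullet> fst p + \<beta> * snd p \<le> c}" using half h by blast
  have le: "\<alpha> \<bullet> y + \<beta> * z \<le> c" if "(y, z) \<in> P" for y z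
    using that h(1) F(2) by (auto simp: hh)
  have gt: "\<alpha> \<bullet> x + \<beta> * (t - e) > c" if "e > 0" for e
    using h(2)[OF that] by (auto simp: hh)
  have neg: "\<beta> < 0" using gt[of 1] le[OF xt] by (simp add: algebra_simps)
  have eq: "\<alpha> \<bullet> x + \<beta> * t = c"
  proof (rule ccontr)
    assume "\<not> ?thesis"
    then have g: "c - (\<alpha> \<bullet> x + \<beta> * t) > 0" using le[OF xt] by simp
    have "(c - (\<alpha> \<bullet> x + \<beta> * t)) / (- \<beta>) > 0" using g neg by (simp add: divide_pos_neg divide_neg_neg)
    from gt[OF this] show False using neg by (simp add: field_simps)
  qed
  show ?thesis
  proof
    show "linear (\<lambda>y. (\<alpha> \<bullet> y) / \<beta>)"
      by (auto intro!: linearI simp: inner_add_right add_divide_distrib)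
    show "t + (\<alpha> \<bullet> x) / \<beta> \<le> z + (\<alpha> \<bullet> y) / \<beta>" if "(y, z) \<in> P" for y z
      using le[OF that] eq neg by (simp add: field_simps)
  qed
qed

text \<open>The operator \<^const>\<open>Least\<close> on the reals is meaningful only where a minimum exists; compactness provides one.\<close>

lemma Least_of_compact_fibre:
  fixes P :: "('a::euclidean_space \<times> real) set"
  assumes "compact P" and "x \<in> fst ` P"
  shows "(x, LEAST z. (x, z) \<in> P) \<in> P" and "(x, z) \<in> P \<Longrightarrow> (LEAST z. (x, z) \<in> P) \<le> z"
proof -
  have "{z. (x, z) \<in> P} = snd ` (P \<inter> {x} \<times> UNIV)" by force
  moreover have "compact (P \<inter> {x} \<times> UNIV)"
    using assms(1) by (intro compact_Int_closed closed_Times) auto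
  ultimately have "compact {z. (x, z) \<in> P}"
    by (simp add: compact_continuous_image continuous_on_snd continuous_on_id)
  moreover have "{z. (x, z) \<in> P} \<noteq> {}" using assms(2) by force
  ultimately obtain m where m: "(x, m) \<in> P" "\<And>z. (x, z) \<in> P \<Longrightarrow> m \<le> z"
    using compact_attains_inf by (metis mem_Collect_eq)
  then have "(LEAST z. (x, z) \<in> P) = m" by (intro Least_equality) auto
  with m show "(x, LEAST z. (x, z) \<in> P) \<in> P" "(x, z) \<in> P \<Longrightarrow> (LEAST z. (x, z) \<in> P) \<le> z"
    by auto
qed


section \<open>Cells of an inf-convolution and their components\<close>

locale lower_hulls =
  fixes n :: nat and A :: "nat \<Rightarrow> 'a::euclidean_space set" and \<rho> :: "nat \<Rightarrow> 'a \<Rightarrow> real"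
  assumes A_nonempty: "i \<le> n \<Longrightarrow> A i \<noteq> {}"
    and A_finite: "i \<le> n \<Longrightarrow> finite (A i)"
    and rho_defined: "i \<le> n \<Longrightarrow> defined_on (\<rho> i) (A i)"
begin

abbreviation "\<Delta> \<equiv> \<Sum>i\<le>n. hulls A i"
abbreviation "R \<equiv> inf_convolution n (hulls A) \<rho>"
abbreviation "\<Gamma> i v \<equiv> cell (hulls A i) (\<rho> i) v"
abbreviation "\<Gamma>R v \<equiv> cell \<Delta> R v"

lemma Delta_eq: "\<Delta> = {\<Sum>i\<le>n. y i | y. \<forall>i\<le>n. y i \<in> hulls A i}"
  by (subst set_sum_alt) auto

lemma sum_in_Delta: "(\<And>i. i \<le> n \<Longrightarrow> y i \<in> hulls A i) \<Longrightarrow> (\<Sum>i\<le>n. y i) \<in> \<Delta>"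
  unfolding Delta_eq by blast

lemma compact_Delta: "compact \<Delta>"
proof -
  have "\<Delta> = convex hull (\<Sum>i\<le>n. A i)" by (simp add: convex_hull_set_sum)
  then show ?thesis
    using A_finite by (simp add: finite_set_sum finite_imp_compact_convex_hull)
qed

text \<open>
  The lifted polytope is compact, so the least values that define \<open>\<rho> i\<close> are attained, and its graph is
  the lower boundary of that polytope.
\<close>

lemma lift_of_rho:
  assumes "i \<le> n"
  obtains \<nu> where
    "\<And>x. x \<in> hulls A i \<Longrightarrow> (x, \<rho> i x) \<in> convex hull ((\<lambda>a. (a, \<nu> a)) ` A i)"
    "\<And>x z. (x, z) \<in> convex hull ((\<lambda>a. (a, \<nu> a)) ` A i) \<Longrightarrow> x \<in> hulls A i \<and> \<rho> i x \<le> z"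
proof -
  obtain \<nu> where \<nu>: "\<And>x. x \<in> hulls A i \<Longrightarrow>
      \<rho> i x = (LEAST z. (x, z) \<in> convex hull ((\<lambda>a. (a, \<nu> a)) ` A i))"
    using rho_defined[OF assms] unfolding defined_on_def by blast
  let ?P = "convex hull ((\<lambda>a. (a, \<nu> a)) ` A i)"
  have P: "compact ?P" using A_finite[OF assms] by (simp add: finite_imp_compact_convex_hull)
  have fst: "fst ` ?P = hulls A i"
    by (simp add: convex_hull_linear_image[OF linear_fst] image_image)
  show ?thesis
  proof
    show "(x, \<rho> i x) \<in> ?P" if "x \<in> hulls A i" for x
      using Least_of_compact_fibre(1)[OF P, of x] \<nu>[OF that] that fst by simp
    show "x \<in> hulls A i \<and> \<rho> i x \<le> z" if "(x, z) \<in> ?P" for x z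
    proof -
      have x: "x \<in> fst ` ?P" using that by force
      then show ?thesis
        using Least_of_compact_fibre(2)[OF P x that] \<nu>[of x] fst by simp
    qed
  qed
qed

text \<open>
  The inf-convolution is the lower boundary of the Minkowski sum of the lifted polytopes, which is again
  the convex hull of a finite set.
\<close>

lemma lift_of_inf_convolution:
  obtains P where "polytope P"
    "\<And>y. (\<And>i. i \<le> n \<Longrightarrow> y i \<in> hulls A i) \<Longrightarrow> (\<Sum>i\<le>n. y i, \<Sum>i\<le>n. \<rho> i (y i)) \<in> P"
    "\<And>x z. (x, z) \<in> P \<Longrightarrow>
       \<exists>y. (\<forall>i\<le>n. y i \<in> hulls A i) \<and> (\<Sum>i\<le>n. y i) = x \<and> (\<Sum>i\<le>n. \<rho> i (y i)) \<le> z"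
proof -
  have "\<forall>i. \<exists>\<nu>. i \<le> n \<longrightarrow>
    (\<forall>x. x \<in> hulls A i \<longrightarrow> (x, \<rho> i x) \<in> convex hull ((\<lambda>a. (a, \<nu> a)) ` A i)) \<and>
    (\<forall>x z. (x, z) \<in> convex hull ((\<lambda>a. (a, \<nu> a)) ` A i) \<longrightarrow> x \<in> hulls A i \<and> \<rho> i x \<le> z)"
    using lift_of_rho by metis
  then obtain \<nu> where
    \<nu>: "\<And>i x. i \<le> n \<Longrightarrow> x \<in> hulls A i \<Longrightarrow>
          (x, \<rho> i x) \<in> convex hull ((\<lambda>a. (a, \<nu> i a)) ` A i)"
      "\<And>i x z. i \<le> n \<Longrightarrow> (x, z) \<in> convex hull ((\<lambda>a. (a, \<nu> i a)) ` A i) \<Longrightarrow>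
          x \<in> hulls A i \<and> \<rho> i x \<le> z"
    by metis
  define P where "P = (\<Sum>i\<le>n. convex hull ((\<lambda>a. (a, \<nu> i a)) ` A i))"
  have P_eq: "P = {\<Sum>i\<le>n. p i | p. \<forall>i\<le>n. p i \<in> convex hull ((\<lambda>a. (a, \<nu> i a)) ` A i)}"
    unfolding P_def by (subst set_sum_alt) auto
  show ?thesis
  proof
    show "polytope P"
      unfolding P_def convex_hull_set_sum[symmetric] using A_finite
      by (intro polytope_convex_hull finite_set_sum) auto
    show "(\<Sum>i\<le>n. y i, \<Sum>i\<le>n. \<rho> i (y i)) \<in> P" if "\<And>i. i \<le> n \<Longrightarrow> y i \<in> hulls A i" for y
    proof -
      have "(\<Sum>i\<le>n. y i, \<Sum>i\<le>n. \<rho> i (y i)) = (\<Sum>i\<le>n. (y i, \<rho> i (y i)))"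
        by (simp add: prod_eq_iff fst_sum snd_sum)
      then show ?thesis using \<nu>(1) that unfolding P_eq by auto
    qed
    show "\<exists>y. (\<forall>i\<le>n. y i \<in> hulls A i) \<and> (\<Sum>i\<le>n. y i) = x \<and> (\<Sum>i\<le>n. \<rho> i (y i)) \<le> z"
      if xz: "(x, z) \<in> P" for x z
    proof -
      obtain p where p: "(x, z) = (\<Sum>i\<le>n. p i)"
        "\<And>i. i \<le> n \<Longrightarrow> p i \<in> convex hull ((\<lambda>a. (a, \<nu> i a)) ` A i)"
        using xz unfolding P_eq by auto
      have "fst (p i) \<in> hulls A i \<and> \<rho> i (fst (p i)) \<le> snd (p i)" if "i \<le> n" for i
        using \<nu>(2)[OF that, of "fst (p i)" "snd (p i)"] p(2)[OF that] by simp
      moreover have "(\<Sum>i\<le>n. fst (p i)) = x" "(\<Sum>i\<le>n. snd (p i)) = z"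
        using p(1) by (simp_all add: fst_sum[symmetric] snd_sum[symmetric] flip: p(1))
      ultimately show ?thesis
        by (intro exI[of _ "\<lambda>i. fst (p i)"]) (auto intro!: sum_mono)
    qed
  qed
qed

text \<open>
  Compactness of the lifted sum turns the infimum into a minimum.
\<close>

lemma inf_convolution_attained:
  assumes "x \<in> \<Delta>"
  obtains y where "\<And>i. i \<le> n \<Longrightarrow> y i \<in> hulls A i" "(\<Sum>i\<le>n. y i) = x"
    "R x = (\<Sum>i\<le>n. \<rho> i (y i))"
    "\<And>y'. (\<And>i. i \<le> n \<Longrightarrow> y' i \<in> hulls A i) \<Longrightarrow> (\<Sum>i\<le>n. y' i) = x \<Longrightarrow>
       (\<Sum>i\<le>n. \<rho> i (y i)) \<le> (\<Sum>i\<le>n. \<rho> i (y' i))"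
proof -
  obtain P where P: "polytope P"
    "\<And>y. (\<And>i. i \<le> n \<Longrightarrow> y i \<in> hulls A i) \<Longrightarrow> (\<Sum>i\<le>n. y i, \<Sum>i\<le>n. \<rho> i (y i)) \<in> P"
    "\<And>x z. (x, z) \<in> P \<Longrightarrow>
       \<exists>y. (\<forall>i\<le>n. y i \<in> hulls A i) \<and> (\<Sum>i\<le>n. y i) = x \<and> (\<Sum>i\<le>n. \<rho> i (y i)) \<le> z"
    using lift_of_inf_convolution by blast
  have comp: "compact P" using P(1) by (rule polytope_imp_compact)
  have x: "x \<in> fst ` P" using assms P(2) unfolding Delta_eq by force
  obtain y where y: "\<forall>i\<le>n. y i \<in> hulls A i" "(\<Sum>i\<le>n. y i) = x"
    "(\<Sum>i\<le>n. \<rho> i (y i)) \<le> (LEAST z. (x, z) \<in> P)"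
    using P(3)[OF Least_of_compact_fibre(1)[OF comp x]] by blast
  have min: "(\<Sum>i\<le>n. \<rho> i (y i)) \<le> (\<Sum>i\<le>n. \<rho> i (y' i))"
    if "\<And>i. i \<le> n \<Longrightarrow> y' i \<in> hulls A i" "(\<Sum>i\<le>n. y' i) = x" for y'
    using Least_of_compact_fibre(2)[OF comp x, of "\<Sum>i\<le>n. \<rho> i (y' i)"] P(2)[of y', OF that(1)] y(3)
    by (simp add: that(2))
  have "R x = (\<Sum>i\<le>n. \<rho> i (y i))"
    unfolding inf_convolution_def using y(1,2) min by (intro cInf_eq_minimum) auto
  with y min show ?thesis by (intro that) auto
qed

lemma inf_convolution_le:
  assumes "\<And>i. i \<le> n \<Longrightarrow> y i \<in> hulls A i"
  shows "R (\<Sum>i\<le>n. y i) \<le> (\<Sum>i\<le>n. \<rho> i (y i))"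
  using inf_convolution_attained[OF sum_in_Delta[of y, OF assms]] assms by metis

lemma cells_cover:
  assumes "x \<in> \<Delta>"
  obtains v where "linear v" "x \<in> \<Gamma>R v"
proof -
  obtain P where P: "polytope P"
    "\<And>y. (\<And>i. i \<le> n \<Longrightarrow> y i \<in> hulls A i) \<Longrightarrow> (\<Sum>i\<le>n. y i, \<Sum>i\<le>n. \<rho> i (y i)) \<in> P"
    "\<And>x z. (x, z) \<in> P \<Longrightarrow>
       \<exists>y. (\<forall>i\<le>n. y i \<in> hulls A i) \<and> (\<Sum>i\<le>n. y i) = x \<and> (\<Sum>i\<le>n. \<rho> i (y i)) \<le> z"
    using lift_of_inf_convolution by blast
  have on: "(x, R x) \<in> P" if "x \<in> \<Delta>" for x
    using inf_convolution_attained[OF that] P(2) by metis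
  have low: "R x \<le> z" if "(x, z) \<in> P" for x z
    using P(3)[OF that] inf_convolution_le by fastforce
  obtain v where "linear v" "\<And>y z. (y, z) \<in> P \<Longrightarrow> R x + v x \<le> z + v y"
    using polyhedron_lower_support[OF polytope_imp_polyhedron[OF P(1)] on[OF assms] low] by blast
  with on assms show ?thesis by (intro that[of v]) (auto simp: cell_def)
qed

text \<open>
  The half-space \<open>{(x, z). \<nu> a + v a \<le> z + v x}\<close>, where \<open>a\<close> minimises \<open>\<nu> + v\<close> on the finite set
  \<open>A i\<close>, contains all lifted points and hence their hull.  So \<open>a\<close> also minimises \<open>\<rho> i + v\<close> on the
  hull.  In particular a cell that is a single point is a point of \<open>A i\<close>.
\<close>

lemma component_cell_vertex:
  assumes i: "i \<le> n" and v: "linear v"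
  obtains a where "a \<in> A i" "a \<in> \<Gamma> i v"
proof -
  obtain \<nu> where \<nu>:
    "\<And>x. x \<in> hulls A i \<Longrightarrow> (x, \<rho> i x) \<in> convex hull ((\<lambda>a. (a, \<nu> a)) ` A i)"
    "\<And>x z. (x, z) \<in> convex hull ((\<lambda>a. (a, \<nu> a)) ` A i) \<Longrightarrow> x \<in> hulls A i \<and> \<rho> i x \<le> z"
    using lift_of_rho[OF i] by blast
  obtain a where a: "a \<in> A i" "\<And>a'. a' \<in> A i \<Longrightarrow> \<nu> a + v a \<le> \<nu> a' + v a'"
    using ex_is_arg_min_if_finite[OF A_finite[OF i] A_nonempty[OF i], of "\<lambda>a. \<nu> a + v a"]
    by (auto simp: is_arg_min_linorder)
  have lin: "linear (\<lambda>p. snd p + v (fst p))"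
    using v by (auto intro!: linearI simp: linear_add linear_scale algebra_simps)
  have "convex {p. \<nu> a + v a \<le> snd p + v (fst p)}"
    using convex_linear_vimage[OF lin convex_real_interval(1)[of "\<nu> a + v a"]]
    by (simp add: vimage_def atLeast_def)
  then have "convex hull ((\<lambda>a. (a, \<nu> a)) ` A i) \<subseteq> {p. \<nu> a + v a \<le> snd p + v (fst p)}"
    using a(2) by (intro hull_minimal) auto
  then have *: "\<nu> a + v a \<le> \<rho> i x + v x" if "x \<in> hulls A i" for x
    using \<nu>(1)[OF that] by auto
  have "\<rho> i a \<le> \<nu> a" using \<nu>(2)[of a "\<nu> a"] a(1) by (simp add: hull_inc)
  then have "a \<in> \<Gamma> i v"
    unfolding cell_def using a(1) by (auto simp: hull_inc intro: order_trans[OF _ *])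
  with a(1) show ?thesis by (rule that)
qed

text \<open>Minimality is thereby reduced to finitely many inequalities, which makes it stable.\<close>

lemma component_cell_iff:
  assumes "i \<le> n" "linear v"
  shows "x \<in> \<Gamma> i v \<longleftrightarrow> x \<in> hulls A i \<and> (\<forall>a\<in>A i. \<rho> i x + v x \<le> \<rho> i a + v a)"
proof
  assume "x \<in> hulls A i \<and> (\<forall>a\<in>A i. \<rho> i x + v x \<le> \<rho> i a + v a)"
  moreover obtain a where "a \<in> A i" "a \<in> \<Gamma> i v" using component_cell_vertex[OF assms] .
  ultimately show "x \<in> \<Gamma> i v" unfolding cell_def by force
qed (auto simp: cell_def hull_inc)

text \<open>
  Minimising \<open>R + v\<close> over \<open>\<Delta>\<close> amounts to minimising each \<open>\<rho> i + v\<close> separately, since \<open>v\<close> is additive.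
  The next three lemmas are the two directions of this and their consequence for components.
\<close>

lemma sum_of_component_cells:
  assumes v: "linear v" and y: "\<And>i. i \<le> n \<Longrightarrow> y i \<in> \<Gamma> i v"
  shows "(\<Sum>i\<le>n. y i) \<in> \<Gamma>R v" and "R (\<Sum>i\<le>n. y i) = (\<Sum>i\<le>n. \<rho> i (y i))"
proof -
  have lower: "(\<Sum>i\<le>n. \<rho> i (y i)) + v (\<Sum>i\<le>n. y i) \<le> R x + v x" if x: "x \<in> \<Delta>" for x
  proof -
    obtain z where z: "\<And>i. i \<le> n \<Longrightarrow> z i \<in> hulls A i" "(\<Sum>i\<le>n. z i) = x"
      "R x = (\<Sum>i\<le>n. \<rho> i (z i))"
      using inf_convolution_attained[OF x] by metis
    have "(\<Sum>i\<le>n. \<rho> i (y i) + v (y i)) \<le> (\<Sum>i\<le>n. \<rho> i (z i) + v (z i))"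
      using y z(1) by (intro sum_mono) (auto simp: cell_def)
    then show ?thesis using z(2,3) v by (auto simp: sum.distrib linear_sum)
  qed
  have hull: "\<And>i. i \<le> n \<Longrightarrow> y i \<in> hulls A i" using y by (auto simp: cell_def)
  have "(\<Sum>i\<le>n. y i) \<in> \<Delta>" using hull by (rule sum_in_Delta)
  moreover have "R (\<Sum>i\<le>n. y i) \<le> (\<Sum>i\<le>n. \<rho> i (y i))" using hull by (rule inf_convolution_le)
  ultimately show "R (\<Sum>i\<le>n. y i) = (\<Sum>i\<le>n. \<rho> i (y i))" "(\<Sum>i\<le>n. y i) \<in> \<Gamma>R v"
    using lower by (force simp: cell_def)+
qed

lemma summand_in_component_cell:
  assumes v: "linear v" and y: "\<And>i. i \<le> n \<Longrightarrow> y i \<in> hulls A i"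
    and x: "(\<Sum>i\<le>n. y i) \<in> \<Gamma>R v" "R (\<Sum>i\<le>n. y i) = (\<Sum>i\<le>n. \<rho> i (y i))"
    and i: "i \<le> n"
  shows "y i \<in> \<Gamma> i v"
proof -
  have "\<rho> i (y i) + v (y i) \<le> \<rho> i z + v z" if z: "z \<in> hulls A i" for z
  proof -
    let ?y = "y(i := z)"
    have hull: "?y j \<in> hulls A j" if "j \<le> n" for j using y z that by simp
    have "R (\<Sum>j\<le>n. y j) + v (\<Sum>j\<le>n. y j) \<le> R (\<Sum>j\<le>n. ?y j) + v (\<Sum>j\<le>n. ?y j)"
      using x(1) sum_in_Delta[of ?y, OF hull] by (auto simp: cell_def)
    also have "\<dots> \<le> (\<Sum>j\<le>n. \<rho> j (?y j)) + v (\<Sum>j\<le>n. ?y j)"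
      using inf_convolution_le[of ?y, OF hull] by simp
    finally have "(\<Sum>j\<le>n. \<rho> j (y j) + v (y j)) \<le> (\<Sum>j\<le>n. \<rho> j (?y j) + v (?y j))"
      using v x(2) by (simp add: sum.distrib linear_sum)
    then show ?thesis using i by (simp add: sum.remove[of "{..n}" i])
  qed
  with y i show ?thesis by (simp add: cell_def)
qed

lemma cell_component_eq:
  assumes v: "linear v" and i: "i \<le> n"
  shows "cell_component n (hulls A) \<rho> (\<Gamma>R v) i = \<Gamma> i v"
proof
  show "cell_component n (hulls A) \<rho> (\<Gamma>R v) i \<subseteq> \<Gamma> i v"
    unfolding cell_component_def using summand_in_component_cell[OF v _ _ _ i] by auto
next
  show "\<Gamma> i v \<subseteq> cell_component n (hulls A) \<rho> (\<Gamma>R v) i"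
  proof
    fix z assume z: "z \<in> \<Gamma> i v"
    have "\<forall>j. \<exists>a. j \<le> n \<longrightarrow> a \<in> \<Gamma> j v" using component_cell_vertex[OF _ v] by metis
    then obtain a where a: "\<And>j. j \<le> n \<Longrightarrow> a j \<in> \<Gamma> j v" by metis
    let ?y = "a(i := z)"
    have y: "?y j \<in> \<Gamma> j v" if "j \<le> n" for j using a z that by simp
    have "\<forall>j\<le>n. ?y j \<in> hulls A j" using y by (auto simp: cell_def)
    then show "z \<in> cell_component n (hulls A) \<rho> (\<Gamma>R v) i"
      unfolding cell_component_def using sum_of_component_cells[OF v y]
      by (intro CollectI exI[of _ ?y]) auto
  qed
qed

text \<open>
  The inequalities that make \<open>a\<close> the only minimiser are strict and finite in number, so they survive a
  small change of the linear form.
\<close>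

lemma component_vertex_persists:
  assumes i: "i \<le> n" and v: "linear v" and w: "linear w" and a: "\<Gamma> i v = {a}"
  obtains t where "0 < t" "t < 1" "a \<in> \<Gamma> i (\<lambda>u. (1 - t) * v u + t * w u)"
proof -
  have hull: "a \<in> hulls A i" using a unfolding cell_def by blast
  have "\<forall>\<^sub>F t in at_right 0. \<rho> i a + ((1 - t) * v a + t * w a) \<le> \<rho> i a' + ((1 - t) * v a' + t * w a')"
    if a': "a' \<in> A i" for a'
  proof (cases "a' = a")
    case False
    then have "a' \<notin> \<Gamma> i v" using a by simp
    then have "\<rho> i a + v a < \<rho> i a' + v a'"
      using a' a component_cell_iff[OF i v, of a] component_cell_iff[OF i v, of a']
      by (auto simp: hull_inc intro: order_trans)
    then have pos: "0 < (\<rho> i a' + ((1 - 0) * v a' + 0 * w a')) - (\<rho> i a + ((1 - 0) * v a + 0 * w a))"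
      by simp
    have "((\<lambda>t. (\<rho> i a' + ((1 - t) * v a' + t * w a')) - (\<rho> i a + ((1 - t) * v a + t * w a)))
       \<longlongrightarrow> (\<rho> i a' + ((1 - 0) * v a' + 0 * w a')) - (\<rho> i a + ((1 - 0) * v a + 0 * w a))) (at_right 0)"
      by (intro tendsto_intros)
    from order_tendstoD(1)[OF this pos] show ?thesis
      by eventually_elim simp
  qed simp
  then have "\<forall>\<^sub>F t in at_right 0. \<forall>a'\<in>A i.
      \<rho> i a + ((1 - t) * v a + t * w a) \<le> \<rho> i a' + ((1 - t) * v a' + t * w a')"
    using A_finite[OF i] by (simp add: eventually_ball_finite)
  moreover have "\<forall>\<^sub>F t in at_right (0::real). 0 < t \<and> t < 1"
    using eventually_at_right_real[of 0 "1::real"] by (simp add: greaterThanLessThan_iff)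
  ultimately have "\<forall>\<^sub>F t in at_right 0. 0 < t \<and> t < 1 \<and> (\<forall>a'\<in>A i.
      \<rho> i a + ((1 - t) * v a + t * w a) \<le> \<rho> i a' + ((1 - t) * v a' + t * w a'))"
    by eventually_elim simp
  then obtain t where t: "0 < t" "t < 1" "\<forall>a'\<in>A i.
      \<rho> i a + ((1 - t) * v a + t * w a) \<le> \<rho> i a' + ((1 - t) * v a' + t * w a')"
    using eventually_happens' trivial_limit_at_right_real by blast
  have "linear (\<lambda>u. (1 - t) * v u + t * w u)"
    using v w by (auto intro!: linearI simp: linear_add linear_scale algebra_simps)
  with t hull show ?thesis by (intro that[of t]) (auto simp: component_cell_iff[OF i])
qed

end


section \<open>Lattice points and generic shifts\<close>

lemma lattice_span:
  assumes "lattice_of_rank n M"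
  shows "dim (span M) = n"
proof -
  obtain E where E: "independent E" "card E = n" "finite E"
    "M = {\<Sum>e\<in>E. of_int (c e) *\<^sub>R e | c :: 'a \<Rightarrow> int. True}"
    using assms unfolding lattice_of_rank_def by blast
  have "e \<in> M" if "e \<in> E" for e
  proof -
    let ?c = "\<lambda>e'. if e' = e then 1 else 0 :: int"
    have "(\<Sum>e'\<in>E. of_int (?c e') *\<^sub>R e') = (\<Sum>e'\<in>E. if e' = e then e' else 0)"
      by (intro sum.cong) auto
    also have "\<dots> = e" using that E(3) by simp
    finally show ?thesis unfolding E(4) by (intro CollectI exI[of _ ?c] conjI TrueI) (rule sym)
  qed
  moreover have "M \<subseteq> span E"
    unfolding E(4) by (auto intro!: span_sum span_scale intro: span_base)
  ultimately have "span M = span E"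
    by (meson span_mono span_minimal subspace_span subset_antisym subsetI)
  then show ?thesis using E(1,2) by (simp add: dim_eq_card_independent)
qed

text \<open>
  The coordinates of a lattice point in the basis \<open>E\<close> are integers, and each is a linear function, hence
  bounded on a bounded set.
\<close>

lemma finite_bounded_Int_lattice:
  assumes "lattice_of_rank n M" and S: "bounded S"
  shows "finite (S \<inter> M)"
proof -
  obtain E where E: "independent E" "finite E"
    "M = {\<Sum>e\<in>E. of_int (c e) *\<^sub>R e | c :: 'a \<Rightarrow> int. True}"
    using assms unfolding lattice_of_rank_def by blast
  have "\<exists>g :: 'a \<Rightarrow> real. linear g \<and> (\<forall>e'\<in>E. g e' = (if e' = e then 1 else 0))" for e
    using E(1) by (rule linear_independent_extend)
  then obtain g :: "'a \<Rightarrow> 'a \<Rightarrow> real" where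
    g: "\<And>e. linear (g e)" "\<And>e e'. e' \<in> E \<Longrightarrow> g e e' = (if e' = e then 1 else 0)"
    by metis
  have coeff: "g e (\<Sum>e\<in>E. of_int (c e) *\<^sub>R e) = of_int (c e)" if "e \<in> E" for e and c :: "'a \<Rightarrow> int"
    using that E(2) by (simp add: linear_sum[OF g(1)] linear_scale[OF g(1)] g(2) if_distrib sum.delta cong: if_cong)
  have "\<exists>k::int. \<forall>x\<in>S. \<bar>g e x\<bar> \<le> of_int k" for e
  proof -
    have "bounded (g e ` S)" using S g(1) by (simp add: bounded_linear_image linear_conv_bounded_linear)
    then obtain B where B: "\<forall>x\<in>S. \<bar>g e x\<bar> \<le> B" by (auto simp: bounded_iff)
    then show ?thesis by (meson le_of_int_ceiling order_trans)
  qed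
  then obtain k :: "'a \<Rightarrow> int" where k: "\<And>e x. x \<in> S \<Longrightarrow> \<bar>g e x\<bar> \<le> of_int (k e)" by metis
  have "S \<inter> M \<subseteq> (\<lambda>c. \<Sum>e\<in>E. of_int (c e) *\<^sub>R e) ` (\<Pi>\<^sub>E e\<in>E. {- k e..k e})"
  proof
    fix x assume x: "x \<in> S \<inter> M"
    then obtain c :: "'a \<Rightarrow> int" where c: "x = (\<Sum>e\<in>E. of_int (c e) *\<^sub>R e)" using E(3) by blast
    have "\<bar>c e\<bar> \<le> k e" if "e \<in> E" for e
    proof -
      have "\<bar>real_of_int (c e)\<bar> \<le> of_int (k e)" using k[of x e] x coeff[OF that, of c] c by simp
      then show ?thesis by linarith
    qed
    then have "restrict c E \<in> (\<Pi>\<^sub>E e\<in>E. {- k e..k e})" by (force simp: abs_le_iff)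
    moreover have "x = (\<Sum>e\<in>E. of_int (restrict c E e) *\<^sub>R e)" by (simp add: c)
    ultimately show "x \<in> (\<lambda>c. \<Sum>e\<in>E. of_int (c e) *\<^sub>R e) ` (\<Pi>\<^sub>E e\<in>E. {- k e..k e})" by blast
  qed
  then show ?thesis using E(2) by (meson finite_PiE finite_atLeastAtMost_int finite_imageI finite_subset)
qed

lemma aff_dim_less_of_level_set:
  assumes V: "subspace V" and C: "C \<subseteq> V" and w: "linear w" and const: "\<And>x. x \<in> C \<Longrightarrow> w x = (c::real)"
    and u: "u \<in> V" "w u \<noteq> 0"
  shows "aff_dim C < int (dim V)"
proof -
  have level: "affine {x. w x = c}"
    using w by (auto simp: affine_def linear_add linear_scale simp flip: distrib_right)
  have "affine hull C \<subseteq> V" using C V by (simp add: hull_minimal subspace_imp_affine)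
  moreover have "affine hull C \<subseteq> {x. w x = c}" using const level by (intro hull_minimal) auto
  moreover have "\<not> V \<subseteq> {x. w x = c}"
  proof
    assume "V \<subseteq> {x. w x = c}"
    then have "w u = c" "w 0 = c" using u(1) subspace_0[OF V] by auto
    then show False using u(2) linear_0[OF w] by simp
  qed
  moreover have "affine hull V = V" using V by (simp add: subspace_imp_affine)
  ultimately have "affine hull C \<subset> affine hull V" by blast
  then have "aff_dim C < aff_dim V" by (rule aff_dim_psubset)
  then show ?thesis using V by (simp add: aff_dim_subspace)
qed

locale tight_generic_hulls = lower_hulls n A \<rho>
  for n and A :: "nat \<Rightarrow> 'a::euclidean_space set" and \<rho> +
  fixes M :: "'a set" and \<delta> :: 'a
  assumes lattice: "lattice_of_rank n M"
    and A_in_lattice: "i \<le> n \<Longrightarrow> A i \<subseteq> M"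
    and tight: "tight n (hulls A) \<rho>"
    and generic: "generic_shift M n (hulls A) \<rho> \<delta>"
begin

lemma hull_in_span: "i \<le> n \<Longrightarrow> hulls A i \<subseteq> span M"
  using A_in_lattice by (meson hull_minimal order_trans span_superset subspace_imp_convex subspace_span)

lemma Delta_in_span: "\<Delta> \<subseteq> span M"
  unfolding Delta_eq using hull_in_span by (auto intro!: span_sum)

lemma component_cell_cong:
  assumes "i \<le> n" "\<And>u. u \<in> span M \<Longrightarrow> v u = w u"
  shows "\<Gamma> i v = \<Gamma> i w"
  using assms hull_in_span[OF assms(1)] unfolding cell_def by (auto simp: subset_iff)

lemma cell_cong:
  assumes "\<And>u. u \<in> span M \<Longrightarrow> v u = w u"
  shows "\<Gamma>R v = \<Gamma>R w"
  using assms Delta_in_span unfolding cell_def by (auto simp: subset_iff)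

lemma cell_in_mixed_subdivision: "linear v \<Longrightarrow> \<Gamma>R v \<in> mixed_subdivision n (hulls A) \<rho>"
  unfolding mixed_subdivision_def subdivision_def by blast

text \<open>A cell through a point of \<open>M - \<delta>\<close> is not contained in the skeleton.\<close>

lemma full_dimensional_of_generic:
  assumes v: "linear v" and x: "x \<in> \<Gamma>R v" "x + \<delta> \<in> M"
  shows "aff_dim (\<Gamma>R v) = int n"
proof -
  have "\<not> aff_dim (\<Gamma>R v) \<le> int n - 1"
    using generic x cell_in_mixed_subdivision[OF v]
    unfolding generic_shift_def skeleton_def by blast
  moreover have "aff_dim (\<Gamma>R v) \<le> aff_dim (span M)"
    using Delta_in_span by (intro aff_dim_subset) (auto simp: cell_def)
  ultimately show ?thesis
    using lattice_span[OF lattice] by (simp add: aff_dim_subspace)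
qed

text \<open>
  If \<open>x\<close> had two subgradients that differ on \<^term>\<open>span M\<close>, it would lie in the cell of their midpoint
  \<open>m\<close>.  A point of that cell minimises \<open>R + v\<close> and \<open>R + w\<close> at the same time, so \<open>v - w\<close> is constant on
  the cell, which then has dimension less than \<open>n\<close> and meets \<open>M - \<delta>\<close>.
\<close>

lemma generic_subgradient_unique:
  assumes v: "linear v" and w: "linear w" and x: "x \<in> \<Gamma>R v" "x \<in> \<Gamma>R w" "x + \<delta> \<in> M"
    and u: "u \<in> span M"
  shows "v u = w u"
proof (rule ccontr)
  assume ne: "v u \<noteq> w u"
  define m where "m = (\<lambda>u. (v u + w u) / 2)"
  have m: "linear m" using v w
    by (auto intro!: linearI simp: m_def linear_add linear_scale algebra_simps add_divide_distrib)
  have d: "linear (\<lambda>u. v u - w u)" using v w by (rule linear_compose_sub)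
  have xm: "x \<in> \<Gamma>R m" using x by (force simp: cell_def m_def field_simps)
  have const: "v y - w y = v x - w x" if "y \<in> \<Gamma>R m" for y
  proof -
    have y: "y \<in> \<Delta>" "R y + m y \<le> R x + m x" using that x(1) by (auto simp: cell_def)
    then have "R x + v x \<le> R y + v y" "R x + w x \<le> R y + w y" using x by (auto simp: cell_def)
    then show ?thesis using y(2) by (simp add: m_def field_simps)
  qed
  have "\<Gamma>R m \<subseteq> span M" using Delta_in_span by (auto simp: cell_def)
  from aff_dim_less_of_level_set[OF subspace_span this d const u]
  have "aff_dim (\<Gamma>R m) < int n" using ne lattice_span[OF lattice] by simp
  with full_dimensional_of_generic[OF m xm x(3)] show False by simp
qed

text \<open>
  This replaces the choice operators in the definition of a row by the properties for which they stand.
  Uniqueness of the \<open>n\<close>-cell of \<open>b\<close> is uniqueness of the subgradient at \<open>b - \<delta>\<close>.  The maximum defining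
  the row index is over a nonempty set: a tight \<open>n\<close>-cell has \<open>n + 1\<close> nonempty components whose dimensions
  sum to \<open>n\<close>, so some dimension is 0.
\<close>

lemma row_vertex:
  assumes b: "b \<in> index_set M n A \<delta>"
  obtains v where "linear v" "b - \<delta> \<in> \<Gamma>R v" "row_index n A \<rho> \<delta> b \<le> n"
    "\<Gamma> (row_index n A \<rho> \<delta> b) v = {row_point n A \<rho> \<delta> b}"
    "row_point n A \<rho> \<delta> b \<in> A (row_index n A \<rho> \<delta> b)"
proof -
  obtain z where "z \<in> \<Delta>" "b = z + \<delta>" "b \<in> M" using b unfolding index_set_def by blast
  then have x: "b - \<delta> \<in> \<Delta>" "b - \<delta> + \<delta> \<in> M" by simp_all
  obtain v where v: "linear v" "b - \<delta> \<in> \<Gamma>R v" using cells_cover[OF x(1)] .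
  have full: "aff_dim (\<Gamma>R v) = int n" using full_dimensional_of_generic[OF v x(2)] .
  have cell: "cell_of n A \<rho> \<delta> b = \<Gamma>R v"
    unfolding cell_of_def
  proof (rule the_equality, intro conjI)
    show "\<Gamma>R v \<in> mixed_subdivision n (hulls A) \<rho>" using v(1) by (rule cell_in_mixed_subdivision)
    show "b \<in> (\<lambda>x. x + \<delta>) ` \<Gamma>R v" using v(2) by (force intro: image_eqI[of _ _ "b - \<delta>"])
    fix C assume "C \<in> mixed_subdivision n (hulls A) \<rho> \<and> aff_dim C = int n \<and> b \<in> (\<lambda>x. x + \<delta>) ` C"
    then obtain w where w: "linear w" "C = \<Gamma>R w" "b - \<delta> \<in> \<Gamma>R w"
      unfolding mixed_subdivision_def subdivision_def by auto
    then show "C = \<Gamma>R v"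
      using cell_cong[of w v] generic_subgradient_unique[OF w(1) v(1) w(3) v(2) x(2)] by blast
  qed (rule full)
  let ?I = "{i. i \<le> n \<and> aff_dim (cell_component n (hulls A) \<rho> (cell_of n A \<rho> \<delta> b) i) = 0}"
  have I: "?I = {i. i \<le> n \<and> aff_dim (\<Gamma> i v) = 0}"
    using cell_component_eq[OF v(1)] cell by auto
  have "?I \<noteq> {}"
  proof
    assume "?I = {}"
    then have ne: "aff_dim (\<Gamma> i v) \<noteq> 0" if "i \<le> n" for i using I that by blast
    have "1 \<le> aff_dim (\<Gamma> i v)" if "i \<le> n" for i
    proof -
      have "\<Gamma> i v \<noteq> {}" using component_cell_vertex[OF that v(1)] by blast
      then show ?thesis using ne[OF that] aff_dim_negative_iff[of "\<Gamma> i v"] by linarith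
    qed
    then have "(\<Sum>i\<le>n. 1) \<le> (\<Sum>i\<le>n. aff_dim (\<Gamma> i v))" by (intro sum_mono) auto
    moreover have "(\<Sum>i\<le>n. aff_dim (\<Gamma> i v)) = int n"
      using tight full cell_in_mixed_subdivision[OF v(1)] cell_component_eq[OF v(1)]
      unfolding tight_def by auto
    ultimately show False by simp
  qed
  then have "row_index n A \<rho> \<delta> b \<in> ?I" unfolding row_index_def by (intro Max_in) auto
  then have i: "row_index n A \<rho> \<delta> b \<le> n" "aff_dim (\<Gamma> (row_index n A \<rho> \<delta> b) v) = 0"
    using I by auto
  then obtain a where a: "\<Gamma> (row_index n A \<rho> \<delta> b) v = {a}" by (auto simp: aff_dim_eq_0)
  have "row_point n A \<rho> \<delta> b = a"
    unfolding row_point_def cell cell_component_eq[OF v(1) i(1)] a by simp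
  moreover have "a \<in> A (row_index n A \<rho> \<delta> b)"
    using component_cell_vertex[OF i(1) v(1)] a by (metis singletonD)
  ultimately show ?thesis using v i(1) a by (intro that[of v]) auto
qed

lemma finite_index_set: "finite (index_set M n A \<delta>)"
  unfolding index_set_def
  using compact_Delta lattice
  by (intro finite_bounded_Int_lattice compact_imp_bounded compact_continuous_image continuous_intros)

text \<open>
  The weight \<open>\<rho> i\<close> of an entry of row \<open>b\<close> exceeds that of the diagonal entry by at least the difference
  of the heights \<open>R\<close> at the two lattice points, because exchanging one summand of an optimal
  decomposition gives a decomposition of the other point.
\<close>

lemma entry_weight_bound:
  assumes b: "b \<in> index_set M n A \<delta>" and b': "b' \<in> index_set M n A \<delta>"
    and i_def: "i = row_index n A \<rho> \<delta> b" and a_def: "a = row_point n A \<rho> \<delta> b"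
    and a': "b' - b + a \<in> A i"
  shows "R (b' - \<delta>) - R (b - \<delta>) \<le> \<rho> i (b' - b + a) - \<rho> i a"
    and "R (b' - \<delta>) - R (b - \<delta>) = \<rho> i (b' - b + a) - \<rho> i a \<Longrightarrow> b' = b"
proof -
  obtain v where v: "linear v" "b - \<delta> \<in> \<Gamma>R v" "i \<le> n" "\<Gamma> i v = {a}"
    using row_vertex[OF b] by (metis i_def a_def)
  have "b - \<delta> \<in> \<Delta>" using v(2) by (simp add: cell_def)
  then obtain y where y: "\<And>j. j \<le> n \<Longrightarrow> y j \<in> hulls A j" "(\<Sum>j\<le>n. y j) = b - \<delta>"
      "R (b - \<delta>) = (\<Sum>j\<le>n. \<rho> j (y j))"
    using inf_convolution_attained by metis
  have y_cell: "y j \<in> \<Gamma> j v" if "j \<le> n" for j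
    using summand_in_component_cell[OF v(1) y(1) _ _ that] v(2) y(2,3) by simp
  then have ya: "y i = a" using v(3,4) by blast
  let ?y = "y(i := b' - b + a)"
  have hull: "?y j \<in> hulls A j" if "j \<le> n" for j using y(1) that a' by (simp add: hull_inc)
  have sum_y: "(\<Sum>j\<le>n. ?y j) = b' - \<delta>"
    using y(2) ya v(3) by (simp add: sum.remove[of "{..n}" i] algebra_simps)
  have sum_rho: "(\<Sum>j\<le>n. \<rho> j (?y j)) = R (b - \<delta>) - \<rho> i a + \<rho> i (b' - b + a)"
    using y(3) ya v(3) by (simp add: sum.remove[of "{..n}" i])
  show "R (b' - \<delta>) - R (b - \<delta>) \<le> \<rho> i (b' - b + a) - \<rho> i a"
    using inf_convolution_le[of ?y, OF hull] sum_y sum_rho by simp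
  assume eq: "R (b' - \<delta>) - R (b - \<delta>) = \<rho> i (b' - b + a) - \<rho> i a"
  obtain w where w: "linear w" "b' - \<delta> \<in> \<Gamma>R w" using row_vertex[OF b'] by metis
  have w_cell: "?y j \<in> \<Gamma> j w" if "j \<le> n" for j
    using summand_in_component_cell[OF w(1) hull _ _ that] w(2) sum_y sum_rho eq by simp
  \<comment> \<open>The summands of \<open>b - \<delta>\<close> other than \<open>a\<close> minimise for \<open>v\<close> and for \<open>w\<close>, hence for every form between them;
    the vertex \<open>a\<close> does so at least near \<open>v\<close>.  Such a form is then a second subgradient at \<open>b - \<delta>\<close>.\<close>
  obtain t where t: "0 < t" "t < 1" "a \<in> \<Gamma> i (\<lambda>u. (1 - t) * v u + t * w u)"
    using component_vertex_persists[OF v(3,1) w(1) v(4)] .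
  let ?m = "\<lambda>u. (1 - t) * v u + t * w u"
  have m: "linear ?m"
    using v(1) w(1) by (auto intro!: linearI simp: linear_add linear_scale algebra_simps)
  have "y j \<in> \<Gamma> j ?m" if j: "j \<le> n" for j
  proof (cases "j = i")
    case False
    have "\<rho> j (y j) + ?m (y j) \<le> \<rho> j z + ?m z" if z: "z \<in> hulls A j" for z
    proof -
      have "(1 - t) * (\<rho> j (y j) + v (y j)) + t * (\<rho> j (y j) + w (y j))
        \<le> (1 - t) * (\<rho> j z + v z) + t * (\<rho> j z + w z)"
      proof (rule add_mono; rule mult_left_mono)
        show "\<rho> j (y j) + v (y j) \<le> \<rho> j z + v z" using y_cell[OF j] z by (simp add: cell_def)
        show "\<rho> j (y j) + w (y j) \<le> \<rho> j z + w z"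
          using w_cell[OF j] False z by (simp add: cell_def)
      qed (use t in auto)
      then show ?thesis by (simp add: algebra_simps)
    qed
    then show ?thesis using y(1)[OF j] by (simp add: cell_def)
  qed (use t ya in simp)
  from sum_of_component_cells(1)[of ?m y, OF m this]
  have "b - \<delta> \<in> \<Gamma>R ?m" unfolding y(2) .
  moreover have "b - \<delta> + \<delta> \<in> M" using b by (simp add: index_set_def)
  ultimately have vm: "v u = ?m u" if "u \<in> span M" for u
    using generic_subgradient_unique[OF v(1) m v(2) _ _ that] by simp
  have "v u = w u" if "u \<in> span M" for u
  proof -
    have "t * (v u - w u) = 0" using vm[OF that] by (simp add: algebra_simps)
    then show ?thesis using t(1) by simp
  qed
  then have "\<Gamma> i v = \<Gamma> i w" by (rule component_cell_cong[OF v(3)])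
  then have "\<Gamma> i w = {a}" using v(4) by simp
  moreover have "b' - b + a \<in> \<Gamma> i w" using w_cell[OF v(3)] by simp
  ultimately show "b' = b" by simp
qed

end


section \<open>Principal minors of matrices of variables\<close>

text \<open>
  For \<open>\<omega> i a = a\<close> this is the \<open>M\<close>-degree; for \<open>\<omega> = \<rho>\<close> it is the weight that singles out the diagonal
  monomial.
\<close>

definition monomial_weight ::
  "nat \<Rightarrow> (nat \<Rightarrow> 'a set) \<Rightarrow> (nat \<Rightarrow> 'a \<Rightarrow> 'v::real_vector) \<Rightarrow> 'a monomial \<Rightarrow> 'v" where
  "monomial_weight n A \<omega> m = (\<Sum>i\<le>n. \<Sum>a\<in>A i. of_nat (Poly_Mapping.lookup m (i, a)) *\<^sub>R \<omega> i a)"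

lemma monomial_weight_prod:
  assumes "\<And>i. i \<le> n \<Longrightarrow> finite (A i)" and "\<And>b. b \<in> C \<Longrightarrow> r b \<le> n \<and> s b \<in> A (r b)"
  shows "monomial_weight n A \<omega> (\<Sum>b\<in>C. Poly_Mapping.single (r b, s b) 1) = (\<Sum>b\<in>C. \<omega> (r b) (s b))"
proof -
  have inner: "(\<Sum>a\<in>A i. of_nat (Poly_Mapping.lookup (Poly_Mapping.single (r b, s b) (1::nat)) (i, a)) *\<^sub>R \<omega> i a)
      = (if r b = i then \<omega> i (s b) else 0)" if "b \<in> C" "i \<le> n" for b i
  proof -
    have "(\<Sum>a\<in>A i. of_nat (Poly_Mapping.lookup (Poly_Mapping.single (r b, s b) (1::nat)) (i, a)) *\<^sub>R \<omega> i a)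
      = (\<Sum>a\<in>A i. if a = s b then if r b = i then \<omega> i a else 0 else 0)"
      by (intro sum.cong) (auto simp: lookup_single when_def)
    then show ?thesis using assms(1)[OF that(2)] assms(2)[OF that(1)] by auto
  qed
  have "monomial_weight n A \<omega> (\<Sum>b\<in>C. Poly_Mapping.single (r b, s b) 1)
    = (\<Sum>i\<le>n. \<Sum>a\<in>A i. \<Sum>b\<in>C.
        of_nat (Poly_Mapping.lookup (Poly_Mapping.single (r b, s b) (1::nat)) (i, a)) *\<^sub>R \<omega> i a)"
    by (simp add: monomial_weight_def lookup_sum scaleR_sum_left)
  also have "\<dots> = (\<Sum>i\<le>n. \<Sum>b\<in>C. if r b = i then \<omega> i (s b) else 0)"
    by (rule sum.cong[OF refl], subst sum.swap, rule sum.cong[OF refl], rule inner) auto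
  also have "\<dots> = (\<Sum>b\<in>C. \<omega> (r b) (s b))"
    using assms(2) by (subst sum.swap) (auto intro!: sum.cong)
  finally show ?thesis .
qed

lemma monomial_deg_u_prod:
  assumes "finite C" "finite (A i)" "\<And>b. b \<in> C \<Longrightarrow> s b \<in> A (r b)"
  shows "monomial_deg_u A i (\<Sum>b\<in>C. Poly_Mapping.single (r b, s b) 1) = card {b \<in> C. r b = i}"
proof -
  have inner: "(\<Sum>a\<in>A i. Poly_Mapping.lookup (Poly_Mapping.single (r b, s b) (1::nat)) (i, a))
      = (if r b = i then 1 else 0)" if "b \<in> C" for b
    using assms(2) assms(3)[OF that] by (auto simp: lookup_single when_def)
  have "monomial_deg_u A i (\<Sum>b\<in>C. Poly_Mapping.single (r b, s b) 1)
    = (\<Sum>b\<in>C. if r b = i then 1 else 0)"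
    unfolding monomial_deg_u_def lookup_sum
    by (subst sum.swap, rule sum.cong[OF refl], rule inner)
  also have "\<dots> = card {b \<in> C. r b = i}" using assms(1) by (simp add: sum.If_cases Int_def)
  finally show ?thesis .
qed

lemma prod_variable:
  "finite C \<Longrightarrow> (\<Prod>b\<in>C. variable (r b) (s b)) =
     Poly_Mapping.single (\<Sum>b\<in>C. Poly_Mapping.single (r b, s b) 1) 1"
  by (induction C rule: finite_induct) (auto simp: variable_def mult_single)

text \<open>
  Each permutation contributes at most one monomial, so a coefficient of the minor is a signed count of
  the permutations that produce its monomial.
\<close>

lemma lookup_principal_minor_of_variables:
  fixes H :: "'b \<Rightarrow> 'b \<Rightarrow> 'a polynomial"
  assumes "finite C"
    and H: "\<And>b b'. H b b' = (if P b b' then variable (r b) (s b b') else 0)"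
  shows "Poly_Mapping.lookup (principal_minor H C) m =
    (\<Sum>p | p permutes C \<and> (\<forall>b\<in>C. P b (p b)) \<and>
       (\<Sum>b\<in>C. Poly_Mapping.single (r b, s b (p b)) 1) = m. sign p)"
proof -
  let ?m = "\<lambda>p. \<Sum>b\<in>C. Poly_Mapping.single (r b, s b (p b)) (1::nat)"
  have summand: "Poly_Mapping.lookup (of_int (sign p) * (\<Prod>b\<in>C. H b (p b))) m =
      (if (\<forall>b\<in>C. P b (p b)) \<and> ?m p = m then sign p else 0)" for p
  proof (cases "\<forall>b\<in>C. P b (p b)")
    case True
    then have "(\<Prod>b\<in>C. H b (p b)) = Poly_Mapping.single (?m p) 1"
      using assms(1) by (simp add: H prod_variable)
    moreover have "Poly_Mapping.single 0 (of_int (sign p)) = (of_int (sign p) :: 'a polynomial)"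
      by (rule single_of_int)
    then have "of_int (sign p) = (Poly_Mapping.single 0 (sign p) :: 'a polynomial)"
      by (simp only: of_int_eq_id id_apply)
    ultimately have "of_int (sign p) * (\<Prod>b\<in>C. H b (p b)) = Poly_Mapping.single (?m p) (sign p)"
      by (simp only: mult_single add_0_left mult_1_right)
    then show ?thesis using True by (simp only: lookup_single when_def) auto
  next
    case False
    then have "(\<Prod>b\<in>C. H b (p b)) = 0" using assms(1) by (auto simp: H intro!: prod_zero)
    with False show ?thesis by auto
  qed
  have "Poly_Mapping.lookup (principal_minor H C) m =
      (\<Sum>p | p permutes C. if (\<forall>b\<in>C. P b (p b)) \<and> ?m p = m then sign p else 0)"
    by (simp add: principal_minor_def lookup_sum summand)
  also have "\<dots> = (\<Sum>p | p permutes C \<and> (\<forall>b\<in>C. P b (p b)) \<and> ?m p = m. sign p)"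
    using finite_permutations[OF assms(1)] by (simp add: sum.If_cases Int_def)
  finally show ?thesis .
qed

text \<open>
  The differences \<open>\<phi> (p b) - \<phi> b\<close> sum to 0 over \<open>C\<close>.  If the bounds \<open>c b\<close> do too, every inequality is
  an equality.
\<close>

lemma permutation_id_of_potential:
  fixes \<phi> :: "'b \<Rightarrow> real"
  assumes C: "finite C" and p: "p permutes C"
    and le: "\<And>b. b \<in> C \<Longrightarrow> \<phi> (p b) - \<phi> b \<le> c b"
    and strict: "\<And>b. b \<in> C \<Longrightarrow> \<phi> (p b) - \<phi> b = c b \<Longrightarrow> p b = b"
    and total: "(\<Sum>b\<in>C. c b) = 0"
  shows "p = id"
proof -
  have "(\<Sum>b\<in>C. c b - (\<phi> (p b) - \<phi> b)) = 0"
    using total sum.permute[OF p, of \<phi>] by (simp add: sum_subtractf o_def)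
  then have "\<forall>b\<in>C. c b - (\<phi> (p b) - \<phi> b) = 0"
    using C le by (subst (asm) sum_nonneg_eq_0_iff) auto
  then have "p b = b" for b
    using strict[of b] p by (cases "b \<in> C") (auto simp: permutes_not_in)
  then show ?thesis by (simp add: fun_eq_iff)
qed


section \<open>Degrees of the principal minors of the Canny-Emiris matrix\<close>

theorem proposition4p6:
  fixes M :: "'a::euclidean_space set"
    and n :: nat
    and A :: "nat \<Rightarrow> 'a set"
    and \<rho> :: "nat \<Rightarrow> 'a \<Rightarrow> real"
    and \<delta> :: 'a
    and C :: "'a set"
  assumes "lattice_of_rank n M"
    and "\<And>i. i \<le> n \<Longrightarrow> A i \<noteq> {} \<and> finite (A i) \<and> A i \<subseteq> M"
    and "\<And>i. i \<le> n \<Longrightarrow> convex_on (hulls A i) (\<rho> i)"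
    and "\<And>i. i \<le> n \<Longrightarrow> piecewise_affine_on (hulls A i) (\<rho> i)"
    and "\<And>i. i \<le> n \<Longrightarrow> defined_on (\<rho> i) (A i)"
    and "tight n (hulls A) \<rho>"
    and "\<delta> \<in> span M"
    and "generic_shift M n (hulls A) \<rho> \<delta>"
    and "C \<subseteq> index_set M n A \<delta>"
  shows "(\<forall>i\<le>n. homogeneous_wrt (monomial_deg_u A i) (canny_emiris_minor n A \<rho> \<delta> C)) \<and>
    homogeneous_wrt (monomial_deg_M n A) (canny_emiris_minor n A \<rho> \<delta> C) \<and>
    (\<forall>i\<le>n. deg_u A i (canny_emiris_minor n A \<rho> \<delta> C) =
       card ({b \<in> index_set M n A \<delta>. row_index n A \<rho> \<delta> b = i} \<inter> C)) \<and>
    deg_M n A (canny_emiris_minor n A \<rho> \<delta> C) = (\<Sum>b\<in>C. row_point n A \<rho> \<delta> b)"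
proof -
  interpret tight_generic_hulls n A \<rho> M \<delta>
    using assms by unfold_locales auto
  define r where "r = row_index n A \<rho> \<delta>"
  define a where "a = row_point n A \<rho> \<delta>"
  define s where "s = (\<lambda>b b'. b' - b + a b)"
  define \<mu> where "\<mu> = (\<lambda>p. \<Sum>b\<in>C. Poly_Mapping.single (r b, s b (p b)) (1::nat))"
  define admissible where "admissible = (\<lambda>p. p permutes C \<and> (\<forall>b\<in>C. s b (p b) \<in> A (r b)))"
  define H where "H = canny_emiris_minor n A \<rho> \<delta> C"
  have C: "finite C" using assms(9) finite_index_set by (rule finite_subset)
  have row: "r b \<le> n" "a b \<in> A (r b)" if "b \<in> C" for b
    using row_vertex assms(9) that unfolding r_def a_def by (metis subsetD)+
  have lookup_H: "Poly_Mapping.lookup H m = (\<Sum>p | admissible p \<and> \<mu> p = m. sign p)" for m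
    unfolding H_def canny_emiris_minor_def admissible_def \<mu>_def conj_assoc
    by (rule lookup_principal_minor_of_variables[OF C])
      (simp add: canny_emiris_matrix_def r_def s_def a_def Let_def)
  have weight: "monomial_weight n A \<omega> (\<mu> p) = (\<Sum>b\<in>C. \<omega> (r b) (s b (p b)))"
    if "admissible p" for p and \<omega> :: "nat \<Rightarrow> 'a \<Rightarrow> 'v::real_vector"
    unfolding \<mu>_def using that row A_finite
    by (intro monomial_weight_prod) (auto simp: admissible_def)
  have deg_u: "monomial_deg_u A i (\<mu> p) = card {b \<in> C. r b = i}" if "admissible p" "i \<le> n" for p i
    unfolding \<mu>_def using that C A_finite
    by (intro monomial_deg_u_prod) (auto simp: admissible_def)
  have deg_M: "monomial_deg_M n A (\<mu> p) = (\<Sum>b\<in>C. a b)" if "admissible p" for p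
  proof -
    have "monomial_deg_M n A (\<mu> p) = (\<Sum>b\<in>C. p b - b + a b)"
      using weight[OF that, of "\<lambda>i a. a"] by (simp add: monomial_weight_def monomial_deg_M_def s_def)
    also have "\<dots> = (\<Sum>b\<in>C. a b)"
      using that sum.permute[of p C "\<lambda>b. b"]
      by (simp add: admissible_def sum.distrib sum_subtractf o_def)
    finally show ?thesis .
  qed
  have keys: "\<exists>p. admissible p \<and> m = \<mu> p" if "m \<in> Poly_Mapping.keys H" for m
  proof (rule ccontr)
    assume "\<not> ?thesis"
    then have "{p. admissible p \<and> \<mu> p = m} = {}" by blast
    then have "Poly_Mapping.lookup H m = 0" unfolding lookup_H by (simp only: sum.empty)
    with that show False by (simp add: in_keys_iff)
  qed
  have id: "admissible id" using row by (simp add: admissible_def s_def permutes_id)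
  \<comment> \<open>Equal monomials have equal weights, and the diagonal one is attained by the identity only.\<close>
  have unique: "p = id" if p: "admissible p" "\<mu> p = \<mu> id" for p
  proof (rule permutation_id_of_potential[OF C, where \<phi> = "\<lambda>b. R (b - \<delta>)"
        and c = "\<lambda>b. \<rho> (r b) (s b (p b)) - \<rho> (r b) (a b)"])
    show pC: "p permutes C" using p(1) by (simp add: admissible_def)
    show "(\<Sum>b\<in>C. \<rho> (r b) (s b (p b)) - \<rho> (r b) (a b)) = 0"
      using weight[OF p(1), of \<rho>] weight[OF id, of \<rho>] p(2) by (simp add: s_def sum_subtractf)
    fix b assume b: "b \<in> C"
    then have bb: "b \<in> index_set M n A \<delta>" "p b \<in> index_set M n A \<delta>" "s b (p b) \<in> A (r b)"
      using assms(9) p(1) permutes_in_image[OF pC, of b] by (auto simp: admissible_def)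
    show "R (p b - \<delta>) - R (b - \<delta>) \<le> \<rho> (r b) (s b (p b)) - \<rho> (r b) (a b)"
      using entry_weight_bound(1)[OF bb(1,2) refl refl] bb(3) by (simp add: s_def r_def a_def)
    show "p b = b" if "R (p b - \<delta>) - R (b - \<delta>) = \<rho> (r b) (s b (p b)) - \<rho> (r b) (a b)"
      using entry_weight_bound(2)[OF bb(1,2) refl refl] bb(3) that by (simp add: s_def r_def a_def)
  qed
  have "{p. admissible p \<and> \<mu> p = \<mu> id} = {id}" using unique id by blast
  then have "Poly_Mapping.lookup H (\<mu> id) = 1" unfolding lookup_H by (simp add: sign_id)
  then have id_key: "\<mu> id \<in> Poly_Mapping.keys H" by (simp add: in_keys_iff)
  have keys_u: "monomial_deg_u A i ` Poly_Mapping.keys H = {card {b \<in> C. r b = i}}" if "i \<le> n" for i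
    using keys deg_u[OF _ that] id_key by force
  have keys_M: "monomial_deg_M n A ` Poly_Mapping.keys H = {\<Sum>b\<in>C. a b}"
    using keys deg_M id_key by force
  have Bi: "{b \<in> index_set M n A \<delta>. r b = i} \<inter> C = {b \<in> C. r b = i}" for i
    using assms(9) by blast
  have hom: "homogeneous_wrt f H" if "f ` Poly_Mapping.keys H = {d}" for f :: "'a monomial \<Rightarrow> 'd" and d
    unfolding homogeneous_wrt_def using that by blast
  have "deg_u A i H = card {b \<in> C. r b = i}" if "i \<le> n" for i
    unfolding deg_u_def keys_u[OF that] by simp
  moreover have "deg_M n A H = (\<Sum>b\<in>C. a b)"
    unfolding deg_M_def keys_M by simp
  ultimately show ?thesis
    unfolding H_def[symmetric] r_def[symmetric] a_def[symmetric] Bi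
    using hom[OF keys_u] hom[OF keys_M] by blast
qed

end
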